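(* Let $X,Y$ be smooth real Banach spaces. Suppose that $\dim X \geq 3$ or $\dim Y \geq 3$. Then $X\sim_{BJ}Y$ if and only if $X$ is isometrically isomorphic to $Y$.
   Context: All Banach spaces are real. For elements $x,y$ of a Banach space, $x$ is Birkhoff-James orthogonal to $y$, written $x\perp_{BJ}y$, if $\|x+\lambda y\|\geq\|x\|$ for each $\lambda\in\mathbb{R}$. A (possibly nonlinear, possibly non-additive) map $T:X\to Y$ between Banach spaces is a Birkhoff-James orthogonality preserver if it is a bijection and, for all $x,y\in X$, $x\perp_{BJ}y$ if and only if $Tx\perp_{BJ}Ty$. One writes $X\sim_{BJ}Y$ if there exists a Birkhoff-James orthogonality preserver $T:X\to Y$. A Banach space $X$ is smooth if for each nonzero $x\in X$ the set $\nu(x)=\{f\in B_{X^*}: f(x)=\|x\|\}$ is a singleton, where $B_{X^*}$ is the closed unit ball of the dual $X^*$. Isometrically isomorphic means that there is a linear surjective isometry between the spaces. Dimensions may be infinite. *)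

theory Defs
  imports "HOL-Analysis.Analysis" "HOL-Library.Extended_Nat"
begin

definition bj_orthogonal :: "'a::real_normed_vector \<Rightarrow> 'a \<Rightarrow> bool"  (infix "\<bottom>BJ" 50)
  where "x \<bottom>BJ y \<longleftrightarrow> (\<forall>l::real. norm (x + l *\<^sub>R y) \<ge> norm x)"

text \<open>Neither linearity, additivity nor continuity is required of a preserver.\<close>

definition bj_preserver :: "('a::real_normed_vector \<Rightarrow> 'b::real_normed_vector) \<Rightarrow> bool"
  where "bj_preserver T \<longleftrightarrow> bij T \<and> (\<forall>x y. x \<bottom>BJ y \<longleftrightarrow> T x \<bottom>BJ T y)"

definition bj_equivalent :: "'a::real_normed_vector itself \<Rightarrow> 'b::real_normed_vector itself \<Rightarrow> bool"
  where "bj_equivalent X Y \<longleftrightarrow> (\<exists>T::'a \<Rightarrow> 'b. bj_preserver T)"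

definition support_functionals :: "'a::real_normed_vector \<Rightarrow> ('a \<Rightarrow>\<^sub>L real) set"
  where "support_functionals x = {f. norm f \<le> 1 \<and> blinfun_apply f x = norm x}"

definition smooth_space :: "'a::real_normed_vector itself \<Rightarrow> bool"
  where "smooth_space X \<longleftrightarrow> (\<forall>x::'a. x \<noteq> 0 \<longrightarrow> is_singleton (support_functionals x))"

definition isometrically_isomorphic ::
    "'a::real_normed_vector itself \<Rightarrow> 'b::real_normed_vector itself \<Rightarrow> bool"
  where "isometrically_isomorphic X Y \<longleftrightarrow>
    (\<exists>T::'a \<Rightarrow> 'b. linear T \<and> surj T \<and> (\<forall>x. norm (T x) = norm x))"

text \<open>The library's \<^const>\<open>dim\<close> takes the value 0 on infinite-dimensional spaces, hence
  the extended natural number.\<close>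

definition edim :: "'a::real_vector itself \<Rightarrow> enat"
  where "edim X = (if \<exists>B::'a set. finite B \<and> span B = UNIV
                   then enat (dim (UNIV :: 'a set)) else \<infinity>)"

end

theory Submission
  imports Defs
begin

text \<open>In a smooth space every nonzero \<open>x\<close> has a unique support functional, which is linear, is the
  directional derivative of the norm at \<open>x\<close>, and has \<open>{y. x \<bottom>BJ y}\<close> as its kernel. Best
  approximation shows that every finite-dimensional subspace is an intersection of such
  hyperplanes; hence an orthogonality preserver \<open>T\<close> maps the span of a finite set onto the span of
  the image. In dimension at least three the fundamental theorem of projective geometry yields a
  linear \<open>A\<close> with \<open>T x\<close> a nonzero multiple of \<open>A x\<close>, so \<open>A\<close> preserves orthogonality too.
  Then the support functional of \<open>A x\<close> composed with \<open>A\<close> is \<open>norm (A x) / norm x\<close> times that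
  of \<open>x\<close>, which says that \<open>norm (A x) / norm x\<close> has zero derivative along every line avoiding
  the origin. So \<open>A\<close> is a multiple of an isometry; continuity of \<open>A\<close> is never needed.\<close>

section \<open>Sublinear functionals\<close>

definition sublinear :: "('a::real_vector \<Rightarrow> real) \<Rightarrow> bool"
  where "sublinear p \<longleftrightarrow>
    (\<forall>x y. p (x + y) \<le> p x + p y) \<and> (\<forall>c x. 0 \<le> c \<longrightarrow> p (c *\<^sub>R x) = c * p x)"

lemma sublinear_add: "sublinear p \<Longrightarrow> p (x + y) \<le> p x + p y"
  by (simp add: sublinear_def)

lemma sublinear_scale: "sublinear p \<Longrightarrow> 0 \<le> c \<Longrightarrow> p (c *\<^sub>R x) = c * p x"
  by (simp add: sublinear_def)

lemma sublinear_zero: "sublinear p \<Longrightarrow> p 0 = 0"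
  using sublinear_scale[of p 0 0] by simp

lemma sublinear_minus: "sublinear p \<Longrightarrow> - p (- x) \<le> p x"
  using sublinear_add[of p x "- x"] sublinear_zero[of p] by simp

text \<open>An infimum yields only the inequality for positive scalars directly. Applying that
  inequality again with \<open>inverse c\<close> gives the reverse one.\<close>

lemma sublinearI:
  assumes "\<And>x y. p (x + y) \<le> p x + p y"
    and "\<And>c x. 0 < c \<Longrightarrow> p (c *\<^sub>R x) \<le> c * p x"
    and "p 0 = 0"
  shows "sublinear p"
proof -
  have "p (c *\<^sub>R x) = c * p x" if "0 \<le> c" for c x
  proof (cases "c = 0")
    case False
    with that have c: "0 < c" by simp
    have "p (inverse c *\<^sub>R c *\<^sub>R x) \<le> inverse c * p (c *\<^sub>R x)"
      using c by (intro assms(2)) simp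
    then have "c * p x \<le> p (c *\<^sub>R x)"
      using c by (simp add: field_simps)
    with assms(2)[OF c, of x] show ?thesis by simp
  qed (simp add: assms(3))
  with assms(1) show ?thesis by (simp add: sublinear_def)
qed

text \<open>A pointwise minimal sublinear functional must equal the \<open>q\<close> obtained here,
  which forces it to be superadditive; this proves the Hahn-Banach theorem without extending functionals step by step.\<close>

lemma sublinear_shift:
  fixes p :: "'a::real_vector \<Rightarrow> real"
  assumes p: "sublinear p"
  obtains q where "sublinear q" "\<And>x. q x \<le> p x" "\<And>x. q x \<le> p (x + y) - p y"
proof -
  \<comment> \<open>\<open>t = 0\<close> and \<open>t = 1\<close> give the two required bounds.
    Letting \<open>t\<close> range over all nonnegative reals makes \<open>q\<close> sublinear:
    parameters add when vectors are added and scale when vectors are scaled.\<close>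
  define q where "q x = (INF t\<in>{0..}. p (x + t *\<^sub>R y) - t * p y)" for x
  have lower: "- p (- x) \<le> p (x + t *\<^sub>R y) - t * p y" if "0 \<le> t" for x t
    using sublinear_add[OF p, of "x + t *\<^sub>R y" "- x"] sublinear_scale[OF p that, of y] by simp
  have bdd: "bdd_below ((\<lambda>t. p (x + t *\<^sub>R y) - t * p y) ` {0..})" for x
    using lower by (auto intro!: bdd_belowI)
  have le: "q x \<le> p (x + t *\<^sub>R y) - t * p y" if "0 \<le> t" for x t
    unfolding q_def using that by (intro cINF_lower bdd) auto
  have near: "\<exists>t\<ge>0. p (x + t *\<^sub>R y) - t * p y < q x + e" if "e > 0" for x e
    using cINF_less_iff[OF _ bdd, of x "q x + e"] that unfolding q_def by auto
  have "sublinear q"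
  proof (rule sublinearI)
    fix x z
    show "q (x + z) \<le> q x + q z"
    proof (rule field_le_epsilon)
      fix e :: real assume "e > 0"
      then obtain s t where s: "s \<ge> 0" "p (x + s *\<^sub>R y) - s * p y < q x + e / 2"
        and t: "t \<ge> 0" "p (z + t *\<^sub>R y) - t * p y < q z + e / 2"
        using near half_gt_zero by metis
      have "q (x + z) \<le> p ((x + s *\<^sub>R y) + (z + t *\<^sub>R y)) - (s + t) * p y"
        using le[of "s + t" "x + z"] s t by (simp add: algebra_simps)
      with sublinear_add[OF p, of "x + s *\<^sub>R y" "z + t *\<^sub>R y"] s t
      show "q (x + z) \<le> q x + q z + e" by (simp add: algebra_simps)
    qed
  next
    fix c :: real and x assume c: "0 < c"
    show "q (c *\<^sub>R x) \<le> c * q x"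
    proof (rule field_le_epsilon)
      fix e :: real assume "e > 0"
      then obtain t where t: "t \<ge> 0" "p (x + t *\<^sub>R y) - t * p y < q x + e / c"
        using near c by (metis divide_pos_pos)
      have "q (c *\<^sub>R x) \<le> c * (p (x + t *\<^sub>R y) - t * p y)"
        using le[of "c * t" "c *\<^sub>R x"] sublinear_scale[OF p, of c "x + t *\<^sub>R y"] c t
        by (simp add: algebra_simps)
      also have "\<dots> \<le> c * (q x + e / c)"
        using c t by (intro mult_left_mono) auto
      finally show "q (c *\<^sub>R x) \<le> c * q x + e"
        using c by (simp add: algebra_simps)
    qed
  next
    have "0 \<le> q 0"
      unfolding q_def using sublinear_zero[OF p] sublinear_scale[OF p, of _ y]
      by (intro cINF_greatest) auto
    with le[of 0 0] sublinear_zero[OF p] show "q 0 = 0" by simp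
  qed
  moreover have "q x \<le> p x" "q x \<le> p (x + y) - p y" for x
    using le[of 0 x] le[of 1 x] by auto
  ultimately show ?thesis using that by blast
qed

text \<open>Supplies lower bounds for Zorn's lemma. Near-minimisers at two points may be different
  members of \<open>C\<close>, but in a chain the smaller one serves at both points, whence
  subadditivity. The common bound \<open>p\<close> bounds every member below by
  \<open>- p (- x)\<close>, so the infimum is finite.\<close>

lemma sublinear_Inf_chain:
  fixes C :: "('a::real_vector \<Rightarrow> real) set"
  assumes C: "C \<noteq> {}" "\<And>q. q \<in> C \<Longrightarrow> sublinear q"
    and below: "\<And>q x. q \<in> C \<Longrightarrow> q x \<le> p x"
    and chain: "\<And>q r. q \<in> C \<Longrightarrow> r \<in> C \<Longrightarrow> q \<le> r \<or> r \<le> q"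
  shows "sublinear (\<lambda>x. INF q\<in>C. q x)" and "\<And>q x. q \<in> C \<Longrightarrow> (INF q\<in>C. q x) \<le> q x"
proof -
  have "- p (- x) \<le> q x" if "q \<in> C" for q x
    using sublinear_minus[OF C(2)[OF that], of x] below[OF that, of "- x"] by linarith
  then have bdd: "bdd_below ((\<lambda>q. q x) ` C)" for x
    by (auto intro!: bdd_belowI)
  then show le: "(INF q\<in>C. q x) \<le> q x" if "q \<in> C" for q x
    using that by (intro cINF_lower)
  have near: "\<exists>q\<in>C. q x < (INF q\<in>C. q x) + e" if "e > 0" for x e
    using cINF_less_iff[OF C(1) bdd, of x "(INF q\<in>C. q x) + e"] that by auto
  show "sublinear (\<lambda>x. INF q\<in>C. q x)"
  proof (rule sublinearI)
    fix x z
    show "(INF q\<in>C. q (x + z)) \<le> (INF q\<in>C. q x) + (INF q\<in>C. q z)"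
    proof (rule field_le_epsilon)
      fix e :: real assume "e > 0"
      then obtain q r where q: "q \<in> C" "q x < (INF q\<in>C. q x) + e / 2"
        and r: "r \<in> C" "r z < (INF q\<in>C. q z) + e / 2"
        using near half_gt_zero by metis
      obtain s where s: "s \<in> C" "s \<le> q" "s \<le> r"
        using chain[OF q(1) r(1)] q r by auto
      have "(INF q\<in>C. q (x + z)) \<le> s x + s z"
        using le[OF s(1), of "x + z"] sublinear_add[OF C(2)[OF s(1)], of x z] by linarith
      also have "\<dots> \<le> q x + r z"
        using s by (auto simp: le_fun_def intro!: add_mono)
      finally show "(INF q\<in>C. q (x + z)) \<le> (INF q\<in>C. q x) + (INF q\<in>C. q z) + e"
        using q r by linarith
    qed
  next
    fix c :: real and x :: 'a assume c: "0 < c"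
    show "(INF q\<in>C. q (c *\<^sub>R x)) \<le> c * (INF q\<in>C. q x)"
    proof (rule field_le_epsilon)
      fix e :: real assume "e > 0"
      then obtain q where q: "q \<in> C" "q x < (INF q\<in>C. q x) + e / c"
        using near c by (metis divide_pos_pos)
      have "(INF q\<in>C. q (c *\<^sub>R x)) \<le> c * q x"
        using le[OF q(1), of "c *\<^sub>R x"] sublinear_scale[OF C(2)[OF q(1)], of c x] c by simp
      also have "\<dots> \<le> c * ((INF q\<in>C. q x) + e / c)"
        using c q by (intro mult_left_mono) auto
      finally show "(INF q\<in>C. q (c *\<^sub>R x)) \<le> c * (INF q\<in>C. q x) + e"
        using c by (simp add: algebra_simps)
    qed
  next
    have "(\<lambda>q. q 0) ` C = {0::real}"
      using C sublinear_zero by (auto simp: image_iff)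
    then show "(INF q\<in>C. q 0) = 0" by simp
  qed
qed

text \<open>Zorn's lemma, with the order reversed, gives a minimal sublinear \<open>m\<close> below
  \<open>p\<close>. Shifting \<open>m\<close> by any \<open>y\<close> cannot lower it, so
  \<open>m\<close> is additive; additivity extends homogeneity to negative scalars.\<close>

lemma sublinear_dominates_linear:
  fixes p :: "'a::real_vector \<Rightarrow> real"
  assumes p: "sublinear p"
  obtains f where "linear f" "\<And>x. f x \<le> p x"
proof -
  define A where "A = {q. sublinear q \<and> (\<forall>x. q x \<le> p x)}"
  have "\<exists>m\<in>A. \<forall>a\<in>A. a \<le> m \<longrightarrow> a = m"
  proof (rule predicate_Zorn[where P = "\<lambda>q r. r \<le> q"])
    show "partial_order_on A (relation_of (\<lambda>q r. r \<le> q) A)"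
      by (auto simp: partial_order_on_def preorder_on_def relation_of_def refl_on_def trans_def antisym_def)
  next
    fix C assume "C \<in> Chains (relation_of (\<lambda>q r. r \<le> q) A)"
    then have chain: "\<And>q r. q \<in> C \<Longrightarrow> r \<in> C \<Longrightarrow> q \<in> A \<and> (q \<le> r \<or> r \<le> q)"
      by (fastforce simp: Chains_def relation_of_def)
    show "\<exists>u\<in>A. \<forall>a\<in>C. u \<le> a"
    proof (cases "C = {}")
      case True
      then show ?thesis using p by (auto simp: A_def)
    next
      case False
      have C: "\<And>q. q \<in> C \<Longrightarrow> sublinear q" "\<And>q x. q \<in> C \<Longrightarrow> q x \<le> p x"
        "\<And>q r. q \<in> C \<Longrightarrow> r \<in> C \<Longrightarrow> q \<le> r \<or> r \<le> q"
        using chain by (auto simp: A_def)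
      have inf: "sublinear (\<lambda>x. INF q\<in>C. q x)" "\<And>q x. q \<in> C \<Longrightarrow> (INF q\<in>C. q x) \<le> q x"
        using sublinear_Inf_chain[of C p] False C by blast+
      obtain q where "q \<in> C" using False by blast
      then have "(INF q\<in>C. q x) \<le> p x" for x
        using inf(2)[of q x] C(2)[of q x] by linarith
      then have "(\<lambda>x. INF q\<in>C. q x) \<in> A"
        using inf(1) by (simp add: A_def)
      moreover have "\<forall>a\<in>C. (\<lambda>x. INF q\<in>C. q x) \<le> a"
        using inf(2) by (auto simp: le_fun_def)
      ultimately show ?thesis by blast
    qed
  qed
  then obtain m where "m \<in> A" and minA: "\<And>q. q \<in> A \<Longrightarrow> q \<le> m \<Longrightarrow> q = m"
    by blast
  then have m: "sublinear m" "\<And>x. m x \<le> p x" by (simp_all add: A_def)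
  have min: "q = m" if q: "sublinear q" "\<And>x. q x \<le> m x" for q
  proof (rule minA)
    show "q \<in> A" using q(1) order_trans[OF q(2) m(2)] by (simp add: A_def)
    show "q \<le> m" using q(2) by (simp add: le_fun_def)
  qed
  have add: "m (x + y) = m x + m y" for x y
  proof -
    obtain q where "sublinear q" "\<And>x. q x \<le> m x" "\<And>x. q x \<le> m (x + y) - m y"
      using sublinear_shift[OF m(1), of y] by blast
    with min[of q] have "m x \<le> m (x + y) - m y" by auto
    with sublinear_add[OF m(1), of x y] show ?thesis by simp
  qed
  have neg: "m (- x) = - m x" for x
    using add[of x "- x"] sublinear_zero[OF m(1)] by simp
  have "m (c *\<^sub>R x) = c * m x" for c x
    using sublinear_scale[OF m(1), of c x] sublinear_scale[OF m(1), of "- c" "- x"] neg[of x]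
    by (cases "0 \<le> c") auto
  then have "linear m" using add by (intro linearI) auto
  with m(2) that show ?thesis by blast
qed

text \<open>The linear functional is taken below the shift \<open>q\<close> of \<open>p\<close>
  rather than below \<open>p\<close> itself. Since \<open>q (- y)\<close> is at most
  \<open>- p y\<close>, this forces equality at \<open>y\<close>.\<close>

lemma sublinear_touching_linear:
  fixes p :: "'a::real_vector \<Rightarrow> real"
  assumes p: "sublinear p"
  obtains f where "linear f" "\<And>x. f x \<le> p x" "f y = p y"
proof -
  obtain q where q: "sublinear q" "\<And>x. q x \<le> p x" "\<And>x. q x \<le> p (x + y) - p y"
    using sublinear_shift[OF p] by blast
  obtain f where f: "linear f" "\<And>x. f x \<le> q x"
    using sublinear_dominates_linear[OF q(1)] by blast
  have "f (- y) \<le> - p y"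
    using f(2)[of "- y"] q(3)[of "- y"] sublinear_zero[OF p] by simp
  then have "p y \<le> f y" using linear_neg[OF f(1), of y] by simp
  moreover have le: "f x \<le> p x" for x using f(2)[of x] q(2)[of x] by linarith
  ultimately have "f y = p y" using le[of y] by simp
  with f(1) le that show ?thesis by blast
qed

section \<open>Support functionals in smooth spaces\<close>

text \<open>At the origin the whole dual unit ball supports; the value 0 chosen there lets the
  kernel describe orthogonality at every point. Elsewhere the functional keeps norm at most 1 and is
  not rescaled by \<open>norm x\<close>.\<close>

definition duality_map :: "'a::real_normed_vector \<Rightarrow> 'a \<Rightarrow>\<^sub>L real"
  where "duality_map x = (if x = 0 then 0 else the_elem (support_functionals x))"

section \<open>One-sided derivatives of the norm\<close>

lemma norm_quotient_mono:
  fixes x y :: "'a::real_normed_vector"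
  assumes "0 < s" "s \<le> t"
  shows "(norm (x + s *\<^sub>R y) - norm x) / s \<le> (norm (x + t *\<^sub>R y) - norm x) / t"
proof -
  \<comment> \<open>Convexity: \<open>x + s y\<close> is a convex combination of \<open>x\<close>
    and \<open>x + t y\<close>, here multiplied by \<open>t\<close>.\<close>
  have "t *\<^sub>R (x + s *\<^sub>R y) = (t - s) *\<^sub>R x + s *\<^sub>R (x + t *\<^sub>R y)"
    by (simp add: algebra_simps)
  then have "t * norm (x + s *\<^sub>R y) = norm ((t - s) *\<^sub>R x + s *\<^sub>R (x + t *\<^sub>R y))"
    using assms by (metis abs_of_pos norm_scaleR order_less_le_trans)
  also have "\<dots> \<le> (t - s) * norm x + s * norm (x + t *\<^sub>R y)"
    using assms by (intro norm_triangle_le) simp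
  finally show ?thesis using assms by (simp add: field_simps)
qed

lemma norm_quotient_bound:
  fixes x y :: "'a::real_normed_vector"
  assumes "0 < t"
  shows "\<bar>(norm (x + t *\<^sub>R y) - norm x) / t\<bar> \<le> norm y"
proof -
  have "\<bar>norm (x + t *\<^sub>R y) - norm x\<bar> \<le> t * norm y"
    using norm_triangle_ineq3[of "x + t *\<^sub>R y" x] assms by simp
  with assms show ?thesis by (simp add: field_simps)
qed

text \<open>The right-hand directional derivative of the norm at \<open>x\<close> along
  \<open>y\<close>. The quotients increase with \<open>t\<close>, so their infimum is the limit from
  the right.\<close>

definition norm_derivative :: "'a::real_normed_vector \<Rightarrow> 'a \<Rightarrow> real"
  where "norm_derivative x y = (INF t\<in>{0<..}. (norm (x + t *\<^sub>R y) - norm x) / t)"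

lemma norm_derivative_le:
  assumes "0 < t"
  shows "norm_derivative x y \<le> (norm (x + t *\<^sub>R y) - norm x) / t"
  unfolding norm_derivative_def
proof (rule cINF_lower)
  have "- norm y \<le> (norm (x + t *\<^sub>R y) - norm x) / t" if "0 < t" for t
    using norm_quotient_bound[OF that, of x y] by linarith
  then show "bdd_below ((\<lambda>t. (norm (x + t *\<^sub>R y) - norm x) / t) ` {0<..})"
    by (auto intro!: bdd_belowI[of _ "- norm y"])
qed (use assms in simp)

lemma norm_derivative_near:
  assumes "e > 0"
  obtains s where "s > 0"
    "\<And>t. 0 < t \<Longrightarrow> t \<le> s \<Longrightarrow> (norm (x + t *\<^sub>R y) - norm x) / t < norm_derivative x y + e"
proof -
  have "\<exists>s>0. (norm (x + s *\<^sub>R y) - norm x) / s < norm_derivative x y + e"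
  proof (rule ccontr)
    assume "\<not> ?thesis"
    then have "norm_derivative x y + e \<le> (norm (x + t *\<^sub>R y) - norm x) / t" if "0 < t" for t
      using that not_less by blast
    then have "norm_derivative x y + e \<le> norm_derivative x y"
      by (subst (2) norm_derivative_def, intro cINF_greatest) auto
    with assms show False by simp
  qed
  then show ?thesis
    using that norm_quotient_mono by (metis order_le_less_trans)
qed

lemma sublinear_norm_derivative: "sublinear (norm_derivative x)"
proof (rule sublinearI)
  fix y z
  show "norm_derivative x (y + z) \<le> norm_derivative x y + norm_derivative x z"
  proof (rule field_le_epsilon)
    fix e :: real assume "e > 0"
    then have e: "e / 2 > 0" by simp
    obtain s where s: "s > 0"
      "\<And>t. 0 < t \<Longrightarrow> t \<le> s \<Longrightarrow> (norm (x + t *\<^sub>R y) - norm x) / t < norm_derivative x y + e / 2"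
      using norm_derivative_near[OF e] by blast
    obtain r where r: "r > 0"
      "\<And>t. 0 < t \<Longrightarrow> t \<le> r \<Longrightarrow> (norm (x + t *\<^sub>R z) - norm x) / t < norm_derivative x z + e / 2"
      using norm_derivative_near[OF e] by blast
    \<comment> \<open>\<open>x + t (y + z)\<close> is the midpoint of \<open>x + 2 t y\<close> and
      \<open>x + 2 t z\<close>. Halving makes \<open>2 t\<close> small enough for both
      estimates.\<close>
    define t where "t = min s r / 2"
    have t: "0 < t" "2 * t \<le> s" "2 * t \<le> r" using s r by (auto simp: t_def)
    have "2 *\<^sub>R (x + t *\<^sub>R (y + z)) = (x + (2 * t) *\<^sub>R y) + (x + (2 * t) *\<^sub>R z)"
      by (simp add: algebra_simps scaleR_2)
    then have "2 * norm (x + t *\<^sub>R (y + z)) \<le> norm (x + (2 * t) *\<^sub>R y) + norm (x + (2 * t) *\<^sub>R z)"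
      by (metis abs_numeral norm_scaleR norm_triangle_ineq)
    then have "(norm (x + t *\<^sub>R (y + z)) - norm x) / t
      \<le> (norm (x + (2 * t) *\<^sub>R y) - norm x) / (2 * t) + (norm (x + (2 * t) *\<^sub>R z) - norm x) / (2 * t)"
      using t by (simp add: divide_simps)
    moreover have "(norm (x + (2 * t) *\<^sub>R y) - norm x) / (2 * t) < norm_derivative x y + e / 2"
      using s(2)[of "2 * t"] t by simp
    moreover have "(norm (x + (2 * t) *\<^sub>R z) - norm x) / (2 * t) < norm_derivative x z + e / 2"
      using r(2)[of "2 * t"] t by simp
    moreover have "norm_derivative x (y + z) \<le> (norm (x + t *\<^sub>R (y + z)) - norm x) / t"
      using norm_derivative_le t by blast
    ultimately show "norm_derivative x (y + z) \<le> norm_derivative x y + norm_derivative x z + e"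
      by linarith
  qed
next
  fix c :: real and y assume c: "0 < c"
  have "norm_derivative x (c *\<^sub>R y) / c \<le> norm_derivative x y"
    unfolding norm_derivative_def[of x y]
  proof (rule cINF_greatest)
    fix t :: real assume "t \<in> {0<..}"
    then show "norm_derivative x (c *\<^sub>R y) / c \<le> (norm (x + t *\<^sub>R y) - norm x) / t"
      using norm_derivative_le[of "t / c" x "c *\<^sub>R y"] c by (simp add: field_simps)
  qed simp
  then show "norm_derivative x (c *\<^sub>R y) \<le> c * norm_derivative x y"
    using c by (simp add: field_simps)
next
  show "norm_derivative x 0 = 0" by (simp add: norm_derivative_def)
qed

lemma norm_derivative_le_norm: "norm_derivative x y \<le> norm y"
proof -
  have "norm_derivative x y \<le> norm (x + y) - norm x"
    using norm_derivative_le[of 1 x y] by simp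
  with norm_triangle_ineq[of x y] show ?thesis by linarith
qed

text \<open>A linear functional below the derivative that touches it at \<open>y\<close> is a
  support functional of \<open>x\<close>. By smoothness it is the same one for every
  \<open>y\<close>, so the one-sided derivative is itself linear.\<close>

lemma norm_derivative_eq_duality_map:
  fixes x :: "'a::real_normed_vector"
  assumes smooth: "smooth_space TYPE('a)" and "x \<noteq> 0"
  shows "norm_derivative x y = duality_map x y"
proof -
  have sing: "is_singleton (support_functionals x)"
    using assms by (simp add: smooth_space_def)
  obtain f where f: "linear f" "\<And>z. f z \<le> norm_derivative x z" "f y = norm_derivative x y"
    using sublinear_touching_linear[OF sublinear_norm_derivative] by blast
  have le: "f z \<le> norm z" for z
    using f(2)[of z] norm_derivative_le_norm[of x z] by linarith
  have abs: "norm (f z) \<le> norm z * 1" for z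
    using le[of z] le[of "- z"] linear_neg[OF f(1), of z] by (simp add: abs_le_iff)
  then have bl: "bounded_linear f"
    using f(1) by (metis bounded_linear_axioms.intro bounded_linear.intro)
  have "norm (Blinfun f) \<le> 1"
    by (rule norm_blinfun_bound) (use abs bl in \<open>simp_all add: bounded_linear_Blinfun_apply\<close>)
  \<comment> \<open>The quotient in direction \<open>- x\<close> at \<open>t = 1\<close> runs from
    \<open>x\<close> to the origin.\<close>
  moreover have "f (- x) \<le> - norm x"
    using f(2)[of "- x"] norm_derivative_le[of 1 x "- x"] by simp
  then have "f x = norm x"
    using le[of x] linear_neg[OF f(1), of x] by simp
  ultimately have "Blinfun f \<in> support_functionals x"
    using bl by (simp add: support_functionals_def bounded_linear_Blinfun_apply)
  then have "duality_map x = Blinfun f"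
    using sing \<open>x \<noteq> 0\<close> by (auto simp: duality_map_def is_singleton_def)
  then show ?thesis using f(3) bl by (simp add: bounded_linear_Blinfun_apply)
qed

lemma duality_map_support:
  fixes x :: "'a::real_normed_vector"
  assumes "smooth_space TYPE('a)"
  shows "duality_map x x = norm x" "duality_map x y \<le> norm y"
proof -
  have *: "norm (duality_map x) \<le> 1 \<and> duality_map x x = norm x"
  proof (cases "x = 0")
    case False
    then have "is_singleton (support_functionals x)"
      using assms by (simp add: smooth_space_def)
    then have "the_elem (support_functionals x) \<in> support_functionals x"
      by (metis is_singleton_the_elem singletonI)
    with False show ?thesis by (simp add: duality_map_def support_functionals_def)
  qed (simp add: duality_map_def)
  then show "duality_map x x = norm x" by blast
  have "norm (duality_map x y) \<le> norm (duality_map x) * norm y"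
    by (rule norm_blinfun)
  also have "\<dots> \<le> 1 * norm y" using * by (intro mult_right_mono) auto
  finally show "duality_map x y \<le> norm y" by simp
qed

text \<open>Orthogonality says that the norm along the line through \<open>x\<close> in direction
  \<open>y\<close> is minimal at \<open>x\<close>, so the right derivatives along \<open>y\<close>
  and \<open>- y\<close> are nonnegative; in a smooth space they are opposite numbers. Conversely, a
  support functional vanishing at \<open>y\<close> equals \<open>norm x\<close> on the whole line
  and is dominated by the norm.\<close>

lemma bj_iff_duality_map:
  fixes x y :: "'a::real_normed_vector"
  assumes smooth: "smooth_space TYPE('a)"
  shows "x \<bottom>BJ y \<longleftrightarrow> duality_map x y = 0"
proof (cases "x = 0")
  case True
  then show ?thesis by (simp add: duality_map_def bj_orthogonal_def)
next
  case False
  show ?thesis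
  proof
    assume "duality_map x y = 0"
    then have "duality_map x (x + l *\<^sub>R y) = norm x" for l
      using duality_map_support(1)[OF smooth, of x] by (simp add: blinfun.add_right blinfun.scaleR_right)
    then show "x \<bottom>BJ y"
      unfolding bj_orthogonal_def using duality_map_support(2)[OF smooth] by metis
  next
    assume bj: "x \<bottom>BJ y"
    have "0 \<le> norm_derivative x (c *\<^sub>R y)" for c
      unfolding norm_derivative_def using bj
      by (intro cINF_greatest) (auto simp: bj_orthogonal_def)
    from this[of 1] this[of "- 1"] show "duality_map x y = 0"
      using norm_derivative_eq_duality_map[OF smooth False]
      by (simp add: blinfun.minus_right)
  qed
qed

text \<open>The right derivatives along \<open>y\<close> and \<open>- y\<close> control positive and
  negative increments. Linearity of the support functional makes them opposite, so the derivative is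
  two-sided.\<close>

lemma norm_has_derivative_duality_map:
  fixes x y :: "'a::real_normed_vector"
  assumes smooth: "smooth_space TYPE('a)" and nz: "x + t *\<^sub>R y \<noteq> 0"
  shows "((\<lambda>t. norm (x + t *\<^sub>R y)) has_real_derivative duality_map (x + t *\<^sub>R y) y) (at t)"
proof -
  define w where "w = x + t *\<^sub>R y"
  have eq: "norm_derivative w z = duality_map w z" for z
    using norm_derivative_eq_duality_map[OF smooth, of w] nz by (simp add: w_def)
  have "((\<lambda>h. (norm (w + h *\<^sub>R y) - norm w) / h) \<longlongrightarrow> duality_map w y) (at 0)"
    unfolding LIM_eq
  proof (intro allI impI)
    fix e :: real assume e: "e > 0"
    obtain s where s: "s > 0"
      "\<And>t. 0 < t \<Longrightarrow> t \<le> s \<Longrightarrow> (norm (w + t *\<^sub>R y) - norm w) / t < duality_map w y + e"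
      using norm_derivative_near[OF e, of w y] by (auto simp: eq)
    obtain r where r: "r > 0"
      "\<And>t. 0 < t \<Longrightarrow> t \<le> r \<Longrightarrow> (norm (w + t *\<^sub>R (- y)) - norm w) / t < - duality_map w y + e"
      using norm_derivative_near[OF e, of w "- y"] by (auto simp: eq blinfun.minus_right)
    have "norm ((norm (w + h *\<^sub>R y) - norm w) / h - duality_map w y) < e"
      if "h \<noteq> 0" "\<bar>h\<bar> < min s r" for h
    proof (cases "h > 0")
      case True
      then show ?thesis
        using s(2)[of h] norm_derivative_le[of h w y] that by (simp add: eq)
    next
      case False
      then have h: "0 < - h" "- h \<le> r" using that by auto
      have "(norm (w + h *\<^sub>R y) - norm w) / h = - ((norm (w + (- h) *\<^sub>R (- y)) - norm w) / (- h))"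
        by simp
      then show ?thesis
        using r(2)[OF h] norm_derivative_le[OF h(1), of w "- y"]
        by (simp add: eq blinfun.minus_right)
    qed
    then show "\<exists>d>0. \<forall>h. h \<noteq> 0 \<and> norm (h - 0) < d \<longrightarrow>
        norm ((norm (w + h *\<^sub>R y) - norm w) / h - duality_map w y) < e"
      using s(1) r(1) by (intro exI[of _ "min s r"]) auto
  qed
  then show ?thesis
    unfolding DERIV_def w_def by (simp add: algebra_simps)
qed

section \<open>Best approximation and spans\<close>

text \<open>Best approximation is treated for seminorms because its induction replaces a norm by the
  distance to a line, which vanishes on that line.\<close>

definition seminorm :: "('a::real_vector \<Rightarrow> real) \<Rightarrow> bool"
  where "seminorm N \<longleftrightarrow> (\<forall>x y. N (x + y) \<le> N x + N y) \<and> (\<forall>c x. N (c *\<^sub>R x) = \<bar>c\<bar> * N x)"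

lemma seminorm_attains_on_line:
  assumes N: "seminorm N"
  obtains s where "\<And>t. N (z - s *\<^sub>R b) \<le> N (z - t *\<^sub>R b)"
proof -
  have add: "N (x + y) \<le> N x + N y" and scale: "N (c *\<^sub>R x) = \<bar>c\<bar> * N x" for x y c
    using N by (auto simp: seminorm_def)
  have neg: "N (- x) = N x" for x using scale[of "- 1" x] by simp
  have nonneg: "0 \<le> N x" for x
    using add[of x "- x"] neg[of x] scale[of 0 x] by simp
  have lip: "\<bar>N x - N y\<bar> \<le> N (x - y)" for x y
    using add[of "x - y" y] add[of "y - x" x] neg[of "x - y"] by simp
  show ?thesis
  proof (cases "N b = 0")
    case True
    have "N (z - s *\<^sub>R b) = N (z - t *\<^sub>R b)" for s t
      using lip[of "z - s *\<^sub>R b" "z - t *\<^sub>R b"] scale[of "t - s" b] True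
      by (simp add: algebra_simps)
    then show ?thesis using that[of 0] by (metis order_refl)
  next
    case False
    then have b: "N b > 0" using nonneg[of b] by simp
    \<comment> \<open>Outside \<open>{-R..R}\<close> one has \<open>N (t b) \<ge> 2 N z\<close>,
      hence \<open>N (z - t b) \<ge> N z\<close>, the value at \<open>t = 0\<close>. So a minimum
      over the compact interval is global.\<close>
    define R where "R = 2 * N z / N b"
    have R: "R \<ge> 0" using b nonneg[of z] by (simp add: R_def)
    have lip': "\<bar>N (z - s *\<^sub>R b) - N (z - t *\<^sub>R b)\<bar> \<le> \<bar>s - t\<bar> * N b" for s t
    proof -
      have "(z - s *\<^sub>R b) - (z - t *\<^sub>R b) = (t - s) *\<^sub>R b" by (simp add: algebra_simps)
      then show ?thesis
        using lip[of "z - s *\<^sub>R b" "z - t *\<^sub>R b"] scale[of "t - s" b]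
        by (simp add: abs_minus_commute)
    qed
    have "(N b)-lipschitz_on UNIV (\<lambda>t. N (z - t *\<^sub>R b))"
      using lip' b by (intro lipschitz_onI) (auto simp: dist_real_def mult.commute)
    then have "continuous_on {-R..R} (\<lambda>t. N (z - t *\<^sub>R b))"
      by (metis continuous_on_subset lipschitz_on_continuous_on subset_UNIV)
    then obtain s where s: "s \<in> {-R..R}" "\<And>t. t \<in> {-R..R} \<Longrightarrow> N (z - s *\<^sub>R b) \<le> N (z - t *\<^sub>R b)"
      using continuous_attains_inf[of "{-R..R}" "\<lambda>t. N (z - t *\<^sub>R b)"] R by auto
    have "N (z - s *\<^sub>R b) \<le> N (z - t *\<^sub>R b)" for t
    proof (cases "t \<in> {-R..R}")
      case False
      then have "R * N b \<le> \<bar>t\<bar> * N b" using b by (intro mult_right_mono) auto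
      then have "2 * N z \<le> N (t *\<^sub>R b)" using b by (simp add: R_def scale)
      moreover have "N (t *\<^sub>R b) \<le> N z + N (z - t *\<^sub>R b)"
        using add[of z "t *\<^sub>R b - z"] neg[of "z - t *\<^sub>R b"] by simp
      moreover have "N (z - s *\<^sub>R b) \<le> N z" using s(2)[of 0] R by simp
      ultimately show ?thesis by linarith
    qed (rule s(2))
    then show ?thesis using that by blast
  qed
qed

text \<open>Minimising first over the multiples of \<open>b\<close> leaves a seminorm
  \<open>M\<close>, the \<open>N\<close>-distance to the line of \<open>b\<close>; the induction
  hypothesis for \<open>M\<close> minimises over the rest. This is why \<open>N\<close> is
  generalised in the induction.\<close>

lemma seminorm_attains_on_span:
  assumes "finite S" "seminorm N"
  shows "\<exists>m\<in>span S. \<forall>m'\<in>span S. N (z - m) \<le> N (z - m')"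
  using assms
proof (induction S arbitrary: N rule: finite_induct)
  case empty
  then show ?case by simp
next
  case (insert b S)
  have add: "N (x + y) \<le> N x + N y" and scale: "N (c *\<^sub>R x) = \<bar>c\<bar> * N x" for x y c
    using insert.prems by (auto simp: seminorm_def)
  have "\<exists>s. \<forall>t. N (v - s *\<^sub>R b) \<le> N (v - t *\<^sub>R b)" for v
    by (rule seminorm_attains_on_line[OF insert.prems, of v b]) blast
  then obtain a where a: "\<And>v t. N (v - a v *\<^sub>R b) \<le> N (v - t *\<^sub>R b)"
    by metis
  define M where "M v = N (v - a v *\<^sub>R b)" for v
  have le: "M v \<le> N (v - t *\<^sub>R b)" for v t unfolding M_def by (rule a)
  have M_scale_le: "M (c *\<^sub>R v) \<le> \<bar>c\<bar> * M v" for c v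
    using le[of "c *\<^sub>R v" "c * a v"] scale[of c "v - a v *\<^sub>R b"]
    by (simp add: M_def scaleR_diff_right)
  have "seminorm M"
    unfolding seminorm_def
  proof (intro conjI allI)
    fix x y
    have "M (x + y) \<le> N ((x - a x *\<^sub>R b) + (y - a y *\<^sub>R b))"
      using le[of "x + y" "a x + a y"] by (simp add: algebra_simps)
    also have "\<dots> \<le> M x + M y" unfolding M_def by (rule add)
    finally show "M (x + y) \<le> M x + M y" .
  next
    fix c x
    show "M (c *\<^sub>R x) = \<bar>c\<bar> * M x"
    proof (cases "c = 0")
      case True
      have "0 \<le> M 0"
        using add[of "- (a 0 *\<^sub>R b)" "a 0 *\<^sub>R b"] scale[of 0 0] scale[of "-1" "a 0 *\<^sub>R b"]
        by (simp add: M_def)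
      moreover have "M 0 \<le> 0" using M_scale_le[of 0 x] by simp
      ultimately show ?thesis using True by simp
    next
      case False
      then show ?thesis
        using M_scale_le[of c x] M_scale_le[of "inverse c" "c *\<^sub>R x"]
        by (simp add: field_simps)
    qed
  qed
  then obtain m where m: "m \<in> span S" "\<And>m'. m' \<in> span S \<Longrightarrow> M (z - m) \<le> M (z - m')"
    using insert.IH by blast
  \<comment> \<open>The minimiser for \<open>M\<close>, corrected by the best multiple of
    \<open>b\<close> for the remainder \<open>z - m\<close>.\<close>
  let ?m = "m + a (z - m) *\<^sub>R b"
  have "?m \<in> span (insert b S)"
    using m(1) by (intro span_add span_scale) (auto intro: span_base span_mono[THEN subsetD])
  moreover have "N (z - ?m) \<le> N (z - m')" if "m' \<in> span (insert b S)" for m'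
  proof -
    obtain k where k: "m' - k *\<^sub>R b \<in> span S" using \<open>m' \<in> span (insert b S)\<close> by (auto simp: span_breakdown_eq)
    have "N (z - ?m) = M (z - m)" by (simp add: M_def algebra_simps)
    also have "\<dots> \<le> M (z - (m' - k *\<^sub>R b))" using m(2)[OF k] .
    also have "\<dots> \<le> N (z - m')"
      using le[of "z - (m' - k *\<^sub>R b)" k] by simp
    finally show ?thesis .
  qed
  ultimately show ?case by blast
qed

text \<open>The witness is the error \<open>z - m\<close> of a best approximation \<open>m\<close>
  of \<open>z\<close>. Minimality makes it orthogonal to the span, so its support functional
  vanishes at \<open>m\<close>; at \<open>z\<close> it therefore has the value
  \<open>norm (z - m)\<close>, which is nonzero.\<close>

lemma bj_separates_span:
  fixes z :: "'a::real_normed_vector"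
  assumes smooth: "smooth_space TYPE('a)" and "finite S" "z \<notin> span S"
  shows "\<exists>y. (\<forall>s\<in>S. y \<bottom>BJ s) \<and> \<not> y \<bottom>BJ z"
proof -
  have "seminorm (norm :: 'a \<Rightarrow> real)" by (simp add: seminorm_def norm_triangle_ineq)
  from seminorm_attains_on_span[OF \<open>finite S\<close> this, of z]
  obtain m where m: "m \<in> span S" "\<And>m'. m' \<in> span S \<Longrightarrow> norm (z - m) \<le> norm (z - m')"
    by blast
  have orth: "(z - m) \<bottom>BJ s" if "s \<in> span S" for s
    unfolding bj_orthogonal_def
  proof
    fix l :: real
    have "norm (z - m) \<le> norm (z - (m - l *\<^sub>R s))"
      using m that by (intro m(2) span_diff span_scale)
    then show "norm (z - m) \<le> norm (z - m + l *\<^sub>R s)" by (simp add: algebra_simps)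
  qed
  have "duality_map (z - m) (z - m) \<noteq> 0"
    using \<open>z \<notin> span S\<close> m(1) duality_map_support(1)[OF smooth, of "z - m"] by auto
  moreover have "duality_map (z - m) m = 0"
    using orth[OF m(1)] by (simp add: bj_iff_duality_map[OF smooth])
  ultimately have "\<not> (z - m) \<bottom>BJ z"
    by (simp add: bj_iff_duality_map[OF smooth] blinfun.diff_right)
  with orth show ?thesis using span_base by blast
qed

text \<open>If \<open>T z\<close> were outside the span, a separating vector would exist, and by
  surjectivity it is some \<open>T y\<close>. Then \<open>y\<close> is orthogonal to
  \<open>S\<close> but not to \<open>z\<close>, although the vectors to which \<open>y\<close> is
  orthogonal form a subspace.\<close>

lemma bj_preserver_span:
  fixes T :: "'a::real_normed_vector \<Rightarrow> 'b::real_normed_vector"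
  assumes smooth: "smooth_space TYPE('a)" "smooth_space TYPE('b)" and T: "bj_preserver T"
    and "finite S" "z \<in> span S"
  shows "T z \<in> span (T ` S)"
proof (rule ccontr)
  assume "T z \<notin> span (T ` S)"
  then obtain y' where y': "\<forall>s\<in>S. y' \<bottom>BJ T s" "\<not> y' \<bottom>BJ T z"
    using bj_separates_span[OF smooth(2) finite_imageI[OF \<open>finite S\<close>], of "T z" T] by auto
  obtain y where y: "y' = T y" using T by (metis bij_pointE bj_preserver_def)
  have "S \<subseteq> {v. duality_map y v = 0}"
    using y' T by (auto simp: y bj_preserver_def bj_iff_duality_map[OF smooth(1), symmetric])
  moreover have "subspace {v. duality_map y v = 0}"
    by (auto simp: subspace_def blinfun.add_right blinfun.scaleR_right)
  ultimately have "duality_map y z = 0" using span_minimal \<open>z \<in> span S\<close> by blast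
  then show False
    using y' T by (auto simp: y bj_preserver_def bj_iff_duality_map[OF smooth(1), symmetric])
qed

lemma bj_preserver_inv:
  assumes "bj_preserver T"
  shows "bj_preserver (inv T)"
  using assms unfolding bj_preserver_def
  by (metis bij_imp_bij_inv bij_inv_eq_iff)

section \<open>The fundamental theorem of projective geometry over the reals\<close>

text \<open>A field endomorphism of the reals fixes the rationals and preserves order, since
  nonnegative numbers are squares. Density of the rationals leaves only the identity.\<close>

lemma additive_multiplicative_real_eq_id:
  fixes s :: "real \<Rightarrow> real"
  assumes add: "\<And>x y. s (x + y) = s x + s y" and mult: "\<And>x y. s (x * y) = s x * s y"
    and one: "s 1 = 1"
  shows "s x = x"
proof -
  have zero: "s 0 = 0" using add[of 0 0] by simp
  have neg: "s (- x) = - s x" for x using add[of x "- x"] zero by simp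
  have nat: "s (of_nat n) = of_nat n" for n
    by (induction n) (simp_all add: zero one add)
  have int: "s (of_int k) = of_int k" for k
    by (cases k rule: int_cases2) (simp_all add: nat neg)
  have rat: "s (of_rat q) = of_rat q" for q
  proof (cases q)
    case (Fract a b)
    then have "s (of_rat q) * s (of_int b) = s (of_int a)"
      by (simp add: mult[symmetric] of_rat_rat)
    with Fract show ?thesis by (simp add: int of_rat_rat field_simps)
  qed
  have mono: "s x \<le> s y" if "x \<le> y" for x y
  proof -
    have "s (y - x) = s (sqrt (y - x)) * s (sqrt (y - x))"
      using that by (simp add: mult[symmetric])
    then have "0 \<le> s (y - x)" by simp
    then show ?thesis using add[of x "y - x"] by simp
  qed
  show ?thesis
  proof (rule linorder_cases)
    assume "s x < x"
    then obtain q where "s x < of_rat q" "of_rat q < x" using of_rat_dense by blast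
    with mono[of "of_rat q" x] rat show ?thesis by simp
  next
    assume "x < s x"
    then obtain q where "x < of_rat q" "of_rat q < s x" using of_rat_dense by blast
    with mono[of x "of_rat q"] rat show ?thesis by simp
  qed
qed

section \<open>Linear algebra of lines and planes\<close>

lemma span_pair: "z \<in> span {a, b} \<longleftrightarrow> (\<exists>s t. z = s *\<^sub>R a + t *\<^sub>R b)"
  for a b :: "'a::real_vector"
proof
  assume "z \<in> span {a, b}"
  then obtain k l where "z - k *\<^sub>R a = l *\<^sub>R b"
    by (auto simp: span_breakdown_eq span_singleton)
  then have "z = k *\<^sub>R a + l *\<^sub>R b" by (simp add: algebra_simps)
  then show "\<exists>s t. z = s *\<^sub>R a + t *\<^sub>R b" by blast
next
  assume "\<exists>s t. z = s *\<^sub>R a + t *\<^sub>R b"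
  then show "z \<in> span {a, b}"
    by (metis insertI1 insertI2 singletonI span_add span_base span_scale)
qed

lemma combination_eq:
  fixes u v :: "'v::real_vector"
  assumes "a *\<^sub>R u + b *\<^sub>R v = c *\<^sub>R u + d *\<^sub>R v" "v \<notin> span {u}" "u \<noteq> 0"
  shows "a = c \<and> b = d"
proof -
  have eq: "(b - d) *\<^sub>R v = (c - a) *\<^sub>R u" using assms(1) by (simp add: algebra_simps)
  have "b = d"
  proof (rule ccontr)
    assume "b \<noteq> d"
    then have "v = ((c - a) / (b - d)) *\<^sub>R u"
      using eq by (metis divide_inverse_commute eq_iff_diff_eq_0 left_inverse scaleR_one scaleR_scaleR)
    with assms(2) show False by (metis span_base span_scale singletonI)
  qed
  with eq assms(3) show ?thesis by simp
qed

lemma span_singleton_sym: "u \<in> span {v} \<Longrightarrow> u \<noteq> 0 \<Longrightarrow> v \<in> span {u}"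
  for u v :: "'v::real_vector"
proof -
  assume "u \<in> span {v}" "u \<noteq> 0"
  then obtain c where "u = c *\<^sub>R v" "c \<noteq> 0" by (auto simp: span_singleton)
  then have "v = inverse c *\<^sub>R u" by simp
  then show "v \<in> span {u}" by (metis span_base span_scale singletonI)
qed

lemma span_singleton_trans: "u \<in> span {v} \<Longrightarrow> v \<in> span {w} \<Longrightarrow> u \<in> span {w}"
  for u v w :: "'v::real_vector"
  by (auto simp: span_singleton)

text \<open>\<open>span_iff\<close> covers planes and, with \<open>a = b\<close>, lines. A pair of
  matching hyperplanes is given as data; in the application they are the vectors to which a fixed
  vector and its image are orthogonal.\<close>

locale collineation =
  fixes T :: "'a::real_vector \<Rightarrow> 'b::real_vector"
    and f :: "'a \<Rightarrow> real" and g :: "'b \<Rightarrow> real" and x0 :: 'a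
  assumes bij: "bij T"
    and span_iff: "z \<in> span {a, b} \<longleftrightarrow> T z \<in> span {T a, T b}"
    and linear_f: "linear f" and linear_g: "linear g"
    and hyperplane: "f v = 0 \<longleftrightarrow> g (T v) = 0"
    and f_x0: "f x0 = 1"
    and dim3: "\<And>a b :: 'a. \<exists>v. v \<notin> span {a, b}"
begin

section \<open>The induced map on an affine chart\<close>

definition y0 :: 'b where "y0 = T x0 /\<^sub>R g (T x0)"

text \<open>The affine hyperplane \<open>x0 + ker f\<close> meets every line through the origin outside \<open>ker f\<close>
  exactly once; \<open>\<phi>\<close> is the map that \<open>T\<close> induces on it.\<close>

definition \<phi> :: "'a \<Rightarrow> 'b"
  where "\<phi> h = T (x0 + h) /\<^sub>R g (T (x0 + h)) - y0"

lemmas lin = linear_add[OF linear_f] linear_scale[OF linear_f] linear_diff[OF linear_f]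
  linear_0[OF linear_f] linear_add[OF linear_g] linear_scale[OF linear_g] linear_diff[OF linear_g]
  linear_0[OF linear_g]

lemma span1: "z \<in> span {a} \<longleftrightarrow> T z \<in> span {T a}"
  using span_iff[of z a a] by simp

lemma T_0: "T 0 = 0"
proof -
  obtain z where "T z = 0" using bij by (metis bij_pointE)
  then show ?thesis using span1[of 0 z] span_zero[of "{z}"] by simp
qed

lemma T_eq_0_iff: "T v = 0 \<longleftrightarrow> v = 0"
  using bij T_0 by (metis bij_pointE)

lemma g_chart: "f h = 0 \<Longrightarrow> g (T (x0 + h)) \<noteq> 0"
  using hyperplane[of "x0 + h"] by (simp add: lin f_x0)

lemma g_y0: "g y0 = 1"
  using g_chart[of 0] by (simp add: y0_def lin)

lemma g_\<phi>: "f h = 0 \<Longrightarrow> g (\<phi> h) = 0"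
  using g_chart[of h] by (simp add: \<phi>_def g_y0 lin)

lemma \<phi>_0: "\<phi> 0 = 0"
  by (simp add: \<phi>_def y0_def)

lemma T_chart: "f h = 0 \<Longrightarrow> T (x0 + h) = g (T (x0 + h)) *\<^sub>R (y0 + \<phi> h)"
  using g_chart[of h] by (simp add: \<phi>_def)

text \<open>\<open>k\<close> is a difference of two chart points, so \<open>T k\<close> combines
  their images. Because \<open>T k\<close> lies in the kernel of \<open>g\<close>, the two
  coefficients are opposite and \<open>y0\<close> cancels.\<close>

lemma T_difference:
  assumes h: "f h = 0" and k: "f k = 0"
  obtains s where "T k = s *\<^sub>R (\<phi> (h + k) - \<phi> h)"
proof -
  have "k = 1 *\<^sub>R (x0 + (h + k)) + (- 1) *\<^sub>R (x0 + h)" by simp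
  then have "k \<in> span {x0 + (h + k), x0 + h}" by (subst span_pair) blast
  then obtain a b where "T k = a *\<^sub>R T (x0 + (h + k)) + b *\<^sub>R T (x0 + h)"
    using span_iff span_pair by metis
  moreover have hk: "f (h + k) = 0" using h k by (simp add: lin)
  ultimately obtain c d where Tk: "T k = c *\<^sub>R (y0 + \<phi> (h + k)) + d *\<^sub>R (y0 + \<phi> h)"
    using T_chart[OF h] T_chart[OF hk] by (metis scaleR_scaleR)
  have "g (T k) = 0" using hyperplane k by blast
  then have "d = - c" using g_\<phi>[OF h] g_\<phi>[OF hk] by (simp add: Tk lin g_y0)
  with Tk have "T k = c *\<^sub>R (\<phi> (h + k) - \<phi> h)" by (simp add: algebra_simps)
  then show ?thesis using that by blast
qed

lemma T_\<phi>:
  assumes "f k = 0"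
  shows "\<exists>s. T k = s *\<^sub>R \<phi> k \<and> (k \<noteq> 0 \<longrightarrow> s \<noteq> 0)"
proof -
  obtain s where s: "T k = s *\<^sub>R \<phi> k"
    using T_difference[of 0 k] assms by (auto simp: lin \<phi>_0)
  then have "k \<noteq> 0 \<Longrightarrow> s \<noteq> 0" using T_eq_0_iff[of k] by auto
  with s show ?thesis by blast
qed

text \<open>Lines in direction \<open>k\<close> go to lines in direction \<open>\<phi> k\<close>,
  whatever the base point \<open>h\<close>: both \<open>\<phi> k\<close> and the difference
  \<open>\<phi> (h + k) - \<phi> h\<close> are multiples of \<open>T k\<close>.\<close>

lemma \<phi>_parallel:
  assumes h: "f h = 0" and k: "f k = 0"
  obtains s where "\<phi> (h + k) = \<phi> h + s *\<^sub>R \<phi> k"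
proof (cases "k = 0")
  case True
  then show ?thesis using that[of 0] by simp
next
  case False
  obtain a where a: "T k = a *\<^sub>R \<phi> k" "a \<noteq> 0" using T_\<phi>[OF k] False by blast
  obtain b where b: "T k = b *\<^sub>R (\<phi> (h + k) - \<phi> h)" using T_difference[OF h k] by blast
  have "b \<noteq> 0" using b T_eq_0_iff[of k] False by auto
  then have "\<phi> (h + k) - \<phi> h = T k /\<^sub>R b" using b by simp
  then have "\<phi> (h + k) = \<phi> h + (a / b) *\<^sub>R \<phi> k"
    using a by (simp add: algebra_simps divide_inverse)
  then show ?thesis using that by blast
qed

lemma \<phi>_independent:
  assumes h: "f h = 0" and k: "f k = 0" and "k \<notin> span {h}"
  shows "\<phi> k \<notin> span {\<phi> h}"
proof
  assume "\<phi> k \<in> span {\<phi> h}"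
  then obtain r where r: "\<phi> k = r *\<^sub>R \<phi> h" by (auto simp: span_singleton)
  obtain s where s: "T k = s *\<^sub>R \<phi> k" using T_\<phi>[OF k] by blast
  obtain t where t: "T h = t *\<^sub>R \<phi> h" "h \<noteq> 0 \<Longrightarrow> t \<noteq> 0" using T_\<phi>[OF h] by blast
  \<comment> \<open>For \<open>h = 0\<close> the factor \<open>t\<close> may vanish. This case is
    kept because it gives \<open>\<phi>_nonzero\<close>.\<close>
  have "T k = (if h = 0 then 0 else s * r / t) *\<^sub>R T h"
    using r s t \<phi>_0 by auto
  then have "T k \<in> span {T h}" by (metis span_base span_scale singletonI)
  with span1 \<open>k \<notin> span {h}\<close> show False by blast
qed

lemma \<phi>_nonzero: "f h = 0 \<Longrightarrow> h \<noteq> 0 \<Longrightarrow> \<phi> h \<noteq> 0"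
  using \<phi>_independent[of 0 h] by (simp add: lin \<phi>_0)

text \<open>The parallelogram argument: \<open>\<phi> (h + k)\<close> lies on the line through
  \<open>\<phi> h\<close> in direction \<open>\<phi> k\<close> and on the line through
  \<open>\<phi> k\<close> in direction \<open>\<phi> h\<close>. Independent directions meet in one
  point.\<close>

lemma \<phi>_add_independent:
  assumes h: "f h = 0" "h \<noteq> 0" and k: "f k = 0" "k \<notin> span {h}"
  shows "\<phi> (h + k) = \<phi> h + \<phi> k"
proof -
  obtain s where s: "\<phi> (h + k) = \<phi> h + s *\<^sub>R \<phi> k" using \<phi>_parallel[OF h(1) k(1)] by blast
  obtain r where r: "\<phi> (k + h) = \<phi> k + r *\<^sub>R \<phi> h" using \<phi>_parallel[OF k(1) h(1)] by blast
  have "1 *\<^sub>R \<phi> h + s *\<^sub>R \<phi> k = r *\<^sub>R \<phi> h + 1 *\<^sub>R \<phi> k"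
    using s r by (simp add: add.commute)
  then have "s = 1"
    using combination_eq[OF _ \<phi>_independent[OF h(1) k] \<phi>_nonzero[OF h]] by metis
  with s show ?thesis by simp
qed

text \<open>Dimension three enters here: a vector outside \<open>span {x0, h}\<close>, projected
  along \<open>x0\<close>, gives a vector of the kernel of \<open>f\<close> off the line of
  \<open>h\<close>.\<close>

lemma third_direction:
  obtains l where "f l = 0" "l \<notin> span {h}"
proof -
  obtain v where v: "v \<notin> span {x0, h}" using dim3[of x0 h] by (rule exE)
  have "v - f v *\<^sub>R x0 \<notin> span {h}" using v by (auto simp: span_breakdown_eq)
  moreover have "f (v - f v *\<^sub>R x0) = 0" by (simp add: lin f_x0)
  ultimately show ?thesis using that by blast
qed

text \<open>For collinear \<open>h\<close> and \<open>k\<close>, an auxiliary \<open>l\<close> off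
  their line reduces to the independent case: \<open>\<phi> (h + k + l)\<close> is expanded with
  both bracketings.\<close>

lemma \<phi>_add:
  assumes h: "f h = 0" and k: "f k = 0"
  shows "\<phi> (h + k) = \<phi> h + \<phi> k"
proof -
  consider "h = 0" | "h \<noteq> 0" "k \<notin> span {h}" | "k = 0" | "h \<noteq> 0" "k \<noteq> 0" "k \<in> span {h}"
    by blast
  then show ?thesis
  proof cases
    case 4
    obtain l where l: "f l = 0" "l \<notin> span {h}" using third_direction[of h] by blast
    have lk: "l \<notin> span {k}"
      using l 4 span_singleton_trans by blast
    have hk: "h + k \<in> span {h}" using 4 by (simp add: span_add span_base)
    have "\<phi> ((h + k) + l) = \<phi> (h + k) + \<phi> l"
    proof (cases "h + k = 0")
      case False
      have "l \<notin> span {h + k}" using l hk span_singleton_trans by blast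
      then show ?thesis using \<phi>_add_independent[of "h + k" l] h k l False by (simp add: lin)
    qed (simp add: \<phi>_0)
    moreover have "\<phi> (h + (k + l)) = \<phi> h + \<phi> (k + l)"
    proof (rule \<phi>_add_independent)
      show "k + l \<notin> span {h}" using 4 l by (simp add: span_add_eq)
    qed (use h k l 4 in \<open>simp_all add: lin\<close>)
    moreover have "\<phi> (k + l) = \<phi> k + \<phi> l"
      using \<phi>_add_independent[of k l] k l lk 4 by blast
    ultimately show ?thesis by (simp add: add.assoc)
  qed (use h k \<phi>_add_independent[of h k] \<phi>_0 in auto)
qed

lemma \<phi>_scale_exists:
  assumes h: "f h = 0"
  obtains s where "\<phi> (t *\<^sub>R h) = s *\<^sub>R \<phi> h"
proof (cases "h = 0")
  case False
  show ?thesis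
  proof (cases "t = 0")
    case t: False
    have th: "f (t *\<^sub>R h) = 0" "t *\<^sub>R h \<noteq> 0" using h t False by (simp_all add: lin)
    have "t *\<^sub>R h \<in> span {h}" by (simp add: span_base span_scale)
    then obtain r where r: "T (t *\<^sub>R h) = r *\<^sub>R T h"
      using span1 by (auto simp: span_singleton)
    obtain a where a: "T (t *\<^sub>R h) = a *\<^sub>R \<phi> (t *\<^sub>R h)" "a \<noteq> 0"
      using T_\<phi>[OF th(1)] th(2) by blast
    obtain b where b: "T h = b *\<^sub>R \<phi> h" using T_\<phi>[OF h] by blast
    have "\<phi> (t *\<^sub>R h) = inverse a *\<^sub>R T (t *\<^sub>R h)" using a by simp
    also have "\<dots> = (inverse a * r * b) *\<^sub>R \<phi> h" using r b by simp
    finally show ?thesis by (rule that)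
  qed (use that[of 0] \<phi>_0 in simp)
qed (use that[of 0] \<phi>_0 in simp)

text \<open>Expanding \<open>\<phi> (t (e + h))\<close> by additivity and comparing coefficients
  shows that independent directions are scaled by the same factor.\<close>

lemma \<phi>_scale_transfer:
  assumes h: "f h = 0" "h \<notin> span {e}" and e: "f e = 0" "e \<noteq> 0"
    and s: "\<phi> (t *\<^sub>R e) = s *\<^sub>R \<phi> e"
  shows "\<phi> (t *\<^sub>R h) = s *\<^sub>R \<phi> h"
proof -
  have eh: "f (e + h) = 0" "f (t *\<^sub>R e) = 0" "f (t *\<^sub>R h) = 0" using e h by (simp_all add: lin)
  obtain a where a: "\<phi> (t *\<^sub>R h) = a *\<^sub>R \<phi> h" using \<phi>_scale_exists[OF h(1)] by blast
  obtain b where b: "\<phi> (t *\<^sub>R (e + h)) = b *\<^sub>R \<phi> (e + h)" using \<phi>_scale_exists[OF eh(1)] by blast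
  have "b *\<^sub>R \<phi> e + b *\<^sub>R \<phi> h = s *\<^sub>R \<phi> e + a *\<^sub>R \<phi> h"
    using a b s \<phi>_add[OF e(1) h(1)] \<phi>_add[OF eh(2,3)] by (simp add: scaleR_add_right)
  then have "b = s \<and> b = a"
    by (rule combination_eq[OF _ \<phi>_independent[OF e(1) h] \<phi>_nonzero[OF e]])
  with a show ?thesis by simp
qed

text \<open>The factor \<open>s t\<close> belonging to \<open>t\<close> is the same for all vectors.
  Hence \<open>s\<close> is additive and multiplicative with \<open>s 1 = 1\<close>, so it is the
  identity.\<close>

lemma \<phi>_scale:
  assumes h: "f h = 0"
  shows "\<phi> (t *\<^sub>R h) = t *\<^sub>R \<phi> h"
proof -
  obtain e where e: "f e = 0" "e \<noteq> 0" using third_direction[of 0] by auto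
  have "\<forall>t. \<exists>s. \<phi> (t *\<^sub>R e) = s *\<^sub>R \<phi> e" using \<phi>_scale_exists[OF e(1)] by metis
  then obtain s where se: "\<And>t. \<phi> (t *\<^sub>R e) = s t *\<^sub>R \<phi> e" by metis
  have s: "\<phi> (t *\<^sub>R h) = s t *\<^sub>R \<phi> h" if h: "f h = 0" for t h
  proof (cases "h \<in> span {e}")
    case False
    then show ?thesis using \<phi>_scale_transfer[OF h _ e se] by blast
  next
    case True
    show ?thesis
    proof (cases "h = 0")
      case False
      \<comment> \<open>On the line of \<open>e\<close> the factor is transferred in two moves, from
        \<open>e\<close> to \<open>l\<close> and from \<open>l\<close> to \<open>h\<close>.\<close>
      obtain l where l: "f l = 0" "l \<notin> span {e}" using third_direction[of e] by blast
      have "h \<notin> span {l}"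
        using True False l span_singleton_sym span_singleton_trans by blast
      moreover have "l \<noteq> 0" using l span_0 by blast
      ultimately show ?thesis
        using \<phi>_scale_transfer[OF h _ l(1)] \<phi>_scale_transfer[OF l e se] by blast
    qed (simp add: \<phi>_0)
  qed
  have nz: "\<phi> e \<noteq> 0" using \<phi>_nonzero e by blast
  have fe: "f (t *\<^sub>R e) = 0" for t using e by (simp add: lin)
  have "s t = t"
  proof (rule additive_multiplicative_real_eq_id)
    fix a b
    have "s (a + b) *\<^sub>R \<phi> e = (s a + s b) *\<^sub>R \<phi> e"
      using \<phi>_add[OF fe fe, of a b] by (simp add: scaleR_add_left[symmetric] se)
    with nz show "s (a + b) = s a + s b" by simp
    have "s (a * b) *\<^sub>R \<phi> e = (s a * s b) *\<^sub>R \<phi> e"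
      using s[OF fe, of a b] by (simp add: se)
    with nz show "s (a * b) = s a * s b" by simp
  next
    have "s 1 *\<^sub>R \<phi> e = 1 *\<^sub>R \<phi> e" using se[of 1] by simp
    then show "s 1 = 1" unfolding scaleR_cancel_right using nz by blast
  qed
  with s[OF h] show ?thesis by simp
qed

text \<open>\<open>A\<close> is the linear map sending \<open>x0\<close> to \<open>y0\<close> and
  agreeing with \<open>\<phi>\<close> on the kernel of \<open>f\<close>. A vector off the kernel is
  a multiple of a chart point, where \<open>T\<close> and \<open>A\<close> are proportional by the
  choice of \<open>\<phi>\<close>.\<close>

theorem induced_by_linear:
  obtains A where "linear A" "\<And>v. \<exists>c. c \<noteq> 0 \<and> T v = c *\<^sub>R A v"
proof -
  define A where "A v = f v *\<^sub>R y0 + \<phi> (v - f v *\<^sub>R x0)" for v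
  have ker: "f (v - f v *\<^sub>R x0) = 0" for v by (simp add: lin f_x0)
  have "linear A"
  proof (rule linearI)
    fix u v
    have "(u + v) - f (u + v) *\<^sub>R x0 = (u - f u *\<^sub>R x0) + (v - f v *\<^sub>R x0)"
      by (simp add: lin algebra_simps)
    then show "A (u + v) = A u + A v"
      using \<phi>_add[OF ker ker, of u v] by (simp add: A_def lin algebra_simps)
  next
    fix c v
    have "c *\<^sub>R v - f (c *\<^sub>R v) *\<^sub>R x0 = c *\<^sub>R (v - f v *\<^sub>R x0)"
      by (simp add: lin algebra_simps)
    then show "A (c *\<^sub>R v) = c *\<^sub>R A v"
      using \<phi>_scale[OF ker, of c v] by (simp add: A_def lin algebra_simps)
  qed
  moreover have "\<exists>c. c \<noteq> 0 \<and> T v = c *\<^sub>R A v" for v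
  proof (cases "f v = 0")
    case True
    obtain s where "T v = s *\<^sub>R \<phi> v" "v \<noteq> 0 \<Longrightarrow> s \<noteq> 0" using T_\<phi>[OF True] by blast
    then show ?thesis
      using True T_0 \<phi>_0 by (cases "v = 0") (auto simp: A_def intro: exI[of _ "1::real"])
  next
    case False
    define h where "h = (v - f v *\<^sub>R x0) /\<^sub>R f v"
    have h: "f h = 0" using False by (simp add: h_def lin f_x0)
    have v: "v = f v *\<^sub>R (x0 + h)" using False by (simp add: h_def algebra_simps)
    have Av: "A v = f v *\<^sub>R (y0 + \<phi> h)"
      using \<phi>_scale[OF ker, of "inverse (f v)" v] False by (simp add: A_def h_def algebra_simps)
    have "v \<in> span {x0 + h}" using v by (metis span_base span_scale singletonI)
    then obtain r where "T v = r *\<^sub>R T (x0 + h)" using span1 by (auto simp: span_singleton)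
    then have Tv: "T v = (r * g (T (x0 + h)) / f v) *\<^sub>R A v"
      using T_chart[OF h] Av False by (metis (no_types, opaque_lifting)
        nonzero_eq_divide_eq scaleR_scaleR times_divide_eq_left)
    moreover have "v \<noteq> 0" using False by (auto simp: lin)
    then have "T v \<noteq> 0" using T_eq_0_iff by blast
    ultimately show ?thesis by (metis scaleR_zero_left)
  qed
  ultimately show ?thesis using that by blast
qed

end

section \<open>Linear orthogonality preservers\<close>

text \<open>Transfers orthogonality from \<open>T\<close> to \<open>A\<close>, whose values differ
  by factors depending on the vector.\<close>

lemma bj_orthogonal_scale:
  assumes "x \<bottom>BJ y"
  shows "(c *\<^sub>R x) \<bottom>BJ (d *\<^sub>R y)"
proof (cases "c = 0")
  case False
  show ?thesis
    unfolding bj_orthogonal_def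
  proof
    fix l :: real
    have "\<bar>c\<bar> * norm x \<le> \<bar>c\<bar> * norm (x + (l * d / c) *\<^sub>R y)"
      using assms by (intro mult_left_mono) (auto simp: bj_orthogonal_def)
    also have "\<dots> = norm (c *\<^sub>R (x + (l * d / c) *\<^sub>R y))" by simp
    also have "\<dots> = norm (c *\<^sub>R x + l *\<^sub>R d *\<^sub>R y)"
      using False by (simp add: scaleR_add_right)
    finally show "norm (c *\<^sub>R x) \<le> norm (c *\<^sub>R x + l *\<^sub>R d *\<^sub>R y)" by simp
  qed
qed (simp add: bj_orthogonal_def)

lemma linear_bj_preserver_norm:
  fixes A :: "'a::real_normed_vector \<Rightarrow> 'b::real_normed_vector"
  assumes smooth: "smooth_space TYPE('a)" "smooth_space TYPE('b)"
    and A: "linear A" "\<And>v. A v = 0 \<Longrightarrow> v = 0"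
    and pres: "\<And>x y. x \<bottom>BJ y \<Longrightarrow> A x \<bottom>BJ A y"
  shows "\<exists>c>0. \<forall>x. norm (A x) = c * norm x"
proof -
  note lin = linear_add[OF A(1)] linear_scale[OF A(1)] linear_diff[OF A(1)] linear_0[OF A(1)]
  \<comment> \<open>The vector \<open>norm w y - (duality_map w y) w\<close> lies in the kernel of
    the support functional at \<open>w\<close>. Its image therefore lies in the kernel at
    \<open>A w\<close>, and expanding gives the identity.\<close>
  have J: "duality_map (A w) (A y) * norm w = norm (A w) * duality_map w y" if "w \<noteq> 0" for w y
  proof -
    have "duality_map w (norm w *\<^sub>R y - duality_map w y *\<^sub>R w) = 0"
      using duality_map_support(1)[OF smooth(1), of w]
      by (simp add: blinfun.diff_right blinfun.scaleR_right)
    then have "duality_map (A w) (A (norm w *\<^sub>R y - duality_map w y *\<^sub>R w)) = 0"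
      using pres bj_iff_duality_map smooth by metis
    then show ?thesis
      using duality_map_support(1)[OF smooth(2), of "A w"]
      by (simp add: lin blinfun.diff_right blinfun.scaleR_right mult.commute)
  qed
  have ratio: "norm (A x) / norm x = norm (A z) / norm z" if "x \<noteq> 0" "z \<noteq> 0" for x z
  proof (cases "z \<in> span {x}")
    case True
    then obtain k where "z = k *\<^sub>R x" by (auto simp: span_singleton)
    with that show ?thesis by (simp add: lin)
  next
    case False
    define y where "y = z - x"
    have nz: "x + t *\<^sub>R y \<noteq> 0" for t
    proof
      assume 0: "x + t *\<^sub>R y = 0"
      with \<open>x \<noteq> 0\<close> have t: "t \<noteq> 0" by auto
      have "t *\<^sub>R z = (t - 1) *\<^sub>R x" using 0 by (simp add: y_def algebra_simps)
      then have "z = ((t - 1) / t) *\<^sub>R x"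
        using t by (metis divide_inverse_commute left_inverse scaleR_one scaleR_scaleR)
      with False show False by (metis span_base span_scale singletonI)
    qed
    have nz': "A x + t *\<^sub>R A y \<noteq> 0" for t
      using nz[of t] A(2)[of "x + t *\<^sub>R y"] by (auto simp: lin)
    \<comment> \<open>The numerator of the quotient rule vanishes by \<open>J\<close> at
      \<open>w = x + t y\<close>. The line avoids the origin because \<open>z\<close> is not a
      multiple of \<open>x\<close>.\<close>
    have "((\<lambda>t. norm (A x + t *\<^sub>R A y) / norm (x + t *\<^sub>R y)) has_real_derivative 0) (at t)" for t
      by (rule derivative_eq_intros norm_has_derivative_duality_map smooth nz nz')+
        (use J[OF nz, of t y] nz[of t] in \<open>simp_all add: lin\<close>)
    then have "norm (A x + 0 *\<^sub>R A y) / norm (x + 0 *\<^sub>R y) = norm (A x + 1 *\<^sub>R A y) / norm (x + 1 *\<^sub>R y)"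
      using DERIV_isconst_all by blast
    then show ?thesis by (simp add: y_def lin)
  qed
  show ?thesis
  proof (cases "\<exists>e::'a. e \<noteq> 0")
    case True
    then obtain e :: 'a where e: "e \<noteq> 0" by blast
    have "norm (A x) = (norm (A e) / norm e) * norm x" for x
      using ratio[OF e, of x] by (cases "x = 0") (auto simp: lin)
    moreover have "norm (A e) / norm e > 0" using e A(2)[of e] by (intro divide_pos_pos) auto
    ultimately show ?thesis by blast
  next
    \<comment> \<open>In the zero space any positive constant serves; 1 is taken.\<close>
    case False
    then have "x = 0" for x :: 'a by blast
    then show ?thesis by (metis lin(4) mult_zero_right norm_zero zero_less_one)
  qed
qed

section \<open>From orthogonality preservers to isometries\<close>

lemma edim_ge_3:
  assumes "edim TYPE('a::real_vector) \<ge> 3"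
  shows "\<exists>v::'a. v \<notin> span {a, b}"
proof (rule ccontr)
  assume "\<not> ?thesis"
  then have span: "span {a, b} = UNIV" by auto
  have "dim (UNIV :: 'a set) \<le> card {a, b}" by (rule dim_le_card) (simp_all add: span)
  also have "\<dots> \<le> 2" by (simp add: card_insert_if)
  finally have "dim (UNIV :: 'a set) \<le> 2" .
  moreover have "edim TYPE('a) = enat (dim (UNIV :: 'a set))"
    using span unfolding edim_def by (metis finite.emptyI finite.insertI)
  ultimately show False using assms by (simp add: numeral_eq_enat)
qed

lemma bj_preserver_imp_isometry:
  fixes T :: "'a::real_normed_vector \<Rightarrow> 'b::real_normed_vector"
  assumes smooth: "smooth_space TYPE('a)" "smooth_space TYPE('b)"
    and dim: "edim TYPE('a) \<ge> 3" and T: "bj_preserver T"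
  shows "isometrically_isomorphic TYPE('a) TYPE('b)"
proof -
  have bij: "bij T" using T by (simp add: bj_preserver_def)
  have T_iff: "x \<bottom>BJ y \<longleftrightarrow> T x \<bottom>BJ T y" for x y using T by (simp add: bj_preserver_def)
  obtain x1 :: 'a where "x1 \<noteq> 0" using edim_ge_3[OF dim, of 0 0] by auto
  \<comment> \<open>The kernel of \<open>f\<close> consists of the vectors to which
    \<open>x1\<close> is orthogonal, and \<open>T\<close> carries it to the kernel of the support
    functional at \<open>T x1\<close>. Dividing by \<open>norm x1\<close> makes
    \<open>f x1 = 1\<close>.\<close>
  define f where "f v = duality_map x1 v / norm x1" for v
  have inv: "inv T (T v) = v" for v using bij by (simp add: bij_is_inj)
  interpret collineation T f "duality_map (T x1)" x1
  proof
    show "bij T" by (rule bij)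
    show "z \<in> span {a, b} \<longleftrightarrow> T z \<in> span {T a, T b}" for z a b
      using bj_preserver_span[OF smooth T, of "{a, b}" z]
        bj_preserver_span[OF smooth(2,1) bj_preserver_inv[OF T], of "{T a, T b}" "T z"]
      by (auto simp: inv)
    show "f (u + v) = f u + f v" "f (c *\<^sub>R v) = c *\<^sub>R f v" for u v c
      by (simp_all add: f_def blinfun.add_right blinfun.scaleR_right add_divide_distrib)
    show "duality_map (T x1) (u + v) = duality_map (T x1) u + duality_map (T x1) v"
      "duality_map (T x1) (c *\<^sub>R v) = c *\<^sub>R duality_map (T x1) v" for u v c
      by (simp_all add: blinfun.add_right blinfun.scaleR_right)
    show "f v = 0 \<longleftrightarrow> duality_map (T x1) (T v) = 0" for v
      using \<open>x1 \<noteq> 0\<close> T_iff by (simp add: f_def bj_iff_duality_map[OF smooth(1), symmetric]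
          bj_iff_duality_map[OF smooth(2), symmetric])
    show "f x1 = 1"
      using \<open>x1 \<noteq> 0\<close> duality_map_support(1)[OF smooth(1)] by (simp add: f_def)
    show "\<exists>v. v \<notin> span {a, b}" for a b :: 'a by (rule edim_ge_3[OF dim])
  qed
  obtain A where A: "linear A" and TA: "\<And>v. \<exists>c. c \<noteq> 0 \<and> T v = c *\<^sub>R A v"
    using induced_by_linear by blast
  have A_T: "\<exists>d. A v = d *\<^sub>R T v" for v
  proof -
    obtain c where "c \<noteq> 0" "T v = c *\<^sub>R A v" using TA by blast
    then have "A v = inverse c *\<^sub>R T v" by simp
    then show ?thesis by blast
  qed
  have A0: "v = 0" if "A v = 0" for v
    using TA[of v] that T_eq_0_iff[of v] by auto
  have A_bj: "A x \<bottom>BJ A y" if "x \<bottom>BJ y" for x y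
    using A_T[of x] A_T[of y] T_iff that bj_orthogonal_scale by metis
  obtain c where c: "c > 0" "\<And>x. norm (A x) = c * norm x"
    using linear_bj_preserver_norm[OF smooth A A0 A_bj] by blast
  define U where "U v = A (v /\<^sub>R c)" for v
  have "linear U"
    by (rule linearI) (simp_all add: U_def linear_add[OF A] linear_scale[OF A] scaleR_add_right)
  moreover have "norm (U v) = norm v" for v using c by (simp add: U_def)
  \<comment> \<open>Surjectivity is inherited from \<open>T\<close>: each \<open>T x\<close> is a
    multiple of \<open>A x\<close>, so the range of \<open>A\<close> is everything.\<close>
  moreover have "\<exists>v. y = U v" for y
  proof -
    obtain x where x: "y = T x" using bij by (metis bij_pointE)
    obtain d where "T x = d *\<^sub>R A x" using TA by blast
    then have "y = U ((c * d) *\<^sub>R x)" using x c by (simp add: U_def linear_scale[OF A])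
    then show ?thesis by blast
  qed
  then have "surj U" by blast
  ultimately show ?thesis unfolding isometrically_isomorphic_def by blast
qed

section \<open>Symmetry of isometric isomorphism and the equivalence\<close>

lemma isometrically_isomorphic_bij:
  assumes "isometrically_isomorphic TYPE('a::real_normed_vector) TYPE('b::real_normed_vector)"
  obtains T :: "'a::real_normed_vector \<Rightarrow> 'b::real_normed_vector" where "linear T" "bij T" "\<And>x. norm (T x) = norm x"
proof -
  obtain T :: "'a \<Rightarrow> 'b" where T: "linear T" "surj T" "\<And>x. norm (T x) = norm x"
    using assms unfolding isometrically_isomorphic_def by blast
  have "inj T"
    unfolding linear_injective_0[OF T(1)] using T(3) by (metis norm_eq_zero)
  with T that show ?thesis by (simp add: bij_def)
qed

lemma isometrically_isomorphic_sym:
  assumes "isometrically_isomorphic TYPE('a::real_normed_vector) TYPE('b::real_normed_vector)"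
  shows "isometrically_isomorphic TYPE('b) TYPE('a)"
proof -
  obtain T :: "'a \<Rightarrow> 'b" where T: "linear T" "bij T" "\<And>x. norm (T x) = norm x"
    using isometrically_isomorphic_bij[OF assms] by blast
  have right: "T (inv T y) = y" for y using T(2) by (simp add: bij_is_surj surj_f_inv_f)
  have left: "inv T (T x) = x" for x using T(2) by (simp add: bij_is_inj)
  have "linear (inv T)"
  proof (rule linearI)
    show "inv T (u + v) = inv T u + inv T v" for u v
      using left[of "inv T u + inv T v"] by (simp add: linear_add[OF T(1)] right)
    show "inv T (c *\<^sub>R v) = c *\<^sub>R inv T v" for c v
      using left[of "c *\<^sub>R inv T v"] by (simp add: linear_scale[OF T(1)] right)
  qed
  moreover have "surj (inv T)" using left by (metis surjI)
  moreover have "norm (inv T y) = norm y" for y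
    using T(3)[of "inv T y"] by (simp add: right)
  ultimately show ?thesis unfolding isometrically_isomorphic_def by blast
qed

theorem theorem2p5:
  assumes "smooth_space TYPE('a::banach)"
    and "smooth_space TYPE('b::banach)"
    and "edim TYPE('a) \<ge> 3 \<or> edim TYPE('b) \<ge> 3"
  shows "bj_equivalent TYPE('a) TYPE('b) \<longleftrightarrow> isometrically_isomorphic TYPE('a) TYPE('b)"
proof
  assume "bj_equivalent TYPE('a) TYPE('b)"
  then obtain T :: "'a \<Rightarrow> 'b" where T: "bj_preserver T" unfolding bj_equivalent_def by blast
  from assms(3) show "isometrically_isomorphic TYPE('a) TYPE('b)"
  proof
    assume "edim TYPE('a) \<ge> 3"
    then show ?thesis using bj_preserver_imp_isometry assms T by blast
  next
    \<comment> \<open>With only the dimension of the target bounded below, the result is applied to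
      the inverse preserver and the resulting isometry is inverted.\<close>
    assume "edim TYPE('b) \<ge> 3"
    then show ?thesis
      using bj_preserver_imp_isometry[OF assms(2,1) _ bj_preserver_inv[OF T]]
        isometrically_isomorphic_sym by blast
  qed
next
  assume "isometrically_isomorphic TYPE('a) TYPE('b)"
  then obtain T :: "'a \<Rightarrow> 'b" where T: "linear T" "bij T" "\<And>x. norm (T x) = norm x"
    using isometrically_isomorphic_bij by blast
  have "norm (T x + l *\<^sub>R T y) = norm (x + l *\<^sub>R y)" for x y l
    using T(3)[of "x + l *\<^sub>R y"] by (simp add: linear_add[OF T(1)] linear_scale[OF T(1)])
  with T(2,3) have "bj_preserver T" by (simp add: bj_preserver_def bj_orthogonal_def)
  then show "bj_equivalent TYPE('a) TYPE('b)" unfolding bj_equivalent_def by blast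
qed

end
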